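(* For $\varepsilon\ge 0$ define the $2\times 2$ matrices $$A_\varepsilon=\begin{pmatrix}1&-\varepsilon\\ \varepsilon&1\end{pmatrix},\quad B_\varepsilon=\begin{pmatrix}1&-\varepsilon\\0&0\end{pmatrix},\quad C_\varepsilon=\frac{1}{1+\varepsilon^2}\begin{pmatrix}1&-\varepsilon\\ \varepsilon&1\end{pmatrix}$$ and the $4\times 4$ matrix $$P_\varepsilon=\begin{pmatrix}A_\varepsilon&B_\varepsilon\\0&C_\varepsilon\end{pmatrix}.$$ Then the map $[0,\infty)\ni\varepsilon\mapsto P_\varepsilon\in\mathbb{R}^{4\times 4}$ is continuous, $P_\varepsilon\in\mathrm{Sp}(\mathbb{R}^4)$ for all $\varepsilon\ge 0$, and: (i) $P_0\neq I_4$, $\dim\ker(P_0-I_4)\neq 2$ and $\sigma(P_0)=\{1\}$; (ii) for every $\varepsilon>0$ one has $\det(P_\varepsilon-I_4)>0$ and $\operatorname{tr}P_\varepsilon<4$, but $P_\varepsilon$ is not elliptic. Consequently, there exists no neighborhood $\mathcal{U}\subset\mathrm{Sp}(\mathbb{R}^4)$ of $P_0$ such that every $S\in\mathcal{U}$ satisfying $\det(S-I_4)>0$ and $\operatorname{tr}S<4$ is elliptic.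
   Context: $I_n$ denotes the $n\times n$ identity matrix, and $J=\begin{pmatrix}0&I_2\\-I_2&0\end{pmatrix}\in\mathbb{R}^{4\times4}$ is the standard symplectic matrix. $\mathrm{Sp}(\mathbb{R}^4)=\{S\in\mathbb{R}^{4\times 4}: S^TJS=J\}$ is the symplectic group, equipped with the topology induced by some (any) norm on $\mathbb{R}^{4\times 4}$. $\sigma(S)\subset\mathbb{C}$ denotes the spectrum (set of complex eigenvalues) of $S$, and $S^1\subset\mathbb{C}$ is the unit circle. A matrix $S\in\mathrm{Sp}(\mathbb{R}^4)$ is called elliptic if $\sigma(S)\subset S^1\setminus\{\pm1\}$. *)

theory Defs
  imports "HOL-Analysis.Analysis"
begin

definition block_matrix ::
  "'a::zero^2^2 \<Rightarrow> 'a^2^2 \<Rightarrow> 'a^2^2 \<Rightarrow> 'a^2^2 \<Rightarrow> 'a^4^4" where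
  "block_matrix A B C D = vector
     [vector [A $ 1 $ 1, A $ 1 $ 2, B $ 1 $ 1, B $ 1 $ 2],
      vector [A $ 2 $ 1, A $ 2 $ 2, B $ 2 $ 1, B $ 2 $ 2],
      vector [C $ 1 $ 1, C $ 1 $ 2, D $ 1 $ 1, D $ 1 $ 2],
      vector [C $ 2 $ 1, C $ 2 $ 2, D $ 2 $ 1, D $ 2 $ 2]]"

definition symplectic_J :: "real^4^4" where
  "symplectic_J = block_matrix 0 (mat 1) (- mat 1) 0"

definition Sp4 :: "(real^4^4) set" where
  "Sp4 = {S. transpose S ** symplectic_J ** S = symplectic_J}"

definition complex_spectrum :: "real^'n^'n \<Rightarrow> complex set" where
  "complex_spectrum S =
     {z. \<exists>v :: complex^'n. v \<noteq> 0 \<and> map_matrix complex_of_real S *v v = z *s v}"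

definition elliptic :: "real^4^4 \<Rightarrow> bool" where
  "elliptic S \<longleftrightarrow> S \<in> Sp4 \<and> complex_spectrum S \<subseteq> sphere 0 1 - {1, -1}"

definition A_mat :: "real \<Rightarrow> real^2^2" where
  "A_mat e = vector [vector [1, - e], vector [e, 1]]"

definition B_mat :: "real \<Rightarrow> real^2^2" where
  "B_mat e = vector [vector [1, - e], vector [0, 0]]"

definition C_mat :: "real \<Rightarrow> real^2^2" where
  "C_mat e = (1 / (1 + e\<^sup>2)) *\<^sub>R vector [vector [1, - e], vector [e, 1]]"

definition P_mat :: "real \<Rightarrow> real^4^4" where
  "P_mat e = block_matrix (A_mat e) (B_mat e) 0 (C_mat e)"

end

theory Submission
  imports Defs
begin

text \<open>Since \<^term>\<open>P_mat e\<close> is block triangular, its spectrum is that of the diagonal blocks: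
  \<open>1 \<plusminus> i e\<close> and their inverses. These eigenvalues are off the unit circle for every
  \<open>e > 0\<close>, yet they collapse to \<open>1\<close> as \<open>e \<rightarrow> 0\<close>, so ellipticity fails arbitrarily
  close to \<^term>\<open>P_mat 0\<close> although \<open>det (P - I) = e\<^sup>4 / (1 + e\<^sup>2) > 0\<close> and
  \<open>tr P = 2 + 2 / (1 + e\<^sup>2) < 4\<close> there.\<close>

text \<open>Peeling 1, 2 and 3 in turn off the permuted set leaves 24 explicit terms of the Leibniz
  sum, grouped here as the Laplace expansion along the first row.\<close>

lemma det_4:
  "det (M :: 'a::comm_ring_1^4^4) =
     M$1$1 * (M$2$2 * M$3$3 * M$4$4 + M$2$3 * M$3$4 * M$4$2 + M$2$4 * M$3$2 * M$4$3
            - M$2$2 * M$3$4 * M$4$3 - M$2$3 * M$3$2 * M$4$4 - M$2$4 * M$3$3 * M$4$2)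
   - M$1$2 * (M$2$1 * M$3$3 * M$4$4 + M$2$3 * M$3$4 * M$4$1 + M$2$4 * M$3$1 * M$4$3
            - M$2$1 * M$3$4 * M$4$3 - M$2$3 * M$3$1 * M$4$4 - M$2$4 * M$3$3 * M$4$1)
   + M$1$3 * (M$2$1 * M$3$2 * M$4$4 + M$2$2 * M$3$4 * M$4$1 + M$2$4 * M$3$1 * M$4$2
            - M$2$1 * M$3$4 * M$4$2 - M$2$2 * M$3$1 * M$4$4 - M$2$4 * M$3$2 * M$4$1)
   - M$1$4 * (M$2$1 * M$3$2 * M$4$3 + M$2$2 * M$3$3 * M$4$1 + M$2$3 * M$3$1 * M$4$2
            - M$2$1 * M$3$3 * M$4$2 - M$2$2 * M$3$1 * M$4$3 - M$2$3 * M$3$2 * M$4$1)"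
proof -
  have *: "finite {2::4, 3, 4}" "1 \<notin> {2::4, 3, 4}"
    "finite {3::4, 4}" "2 \<notin> {3::4, 4}" "finite {4::4}" "3 \<notin> {4::4}"
    by auto
  show ?thesis
    unfolding det_def UNIV_4
    unfolding sum_over_permutations_insert[OF *(1,2)]
    unfolding sum_over_permutations_insert[OF *(3,4)]
    unfolding sum_over_permutations_insert[OF *(5,6)]
    unfolding permutes_sing
    by (simp add: sign_swap_id permutation_swap_id permutation_compose sign_compose sign_id
        transpose_def algebra_simps)
qed

lemma vector_4 [simp]:
  "(vector [x, y, z, w] :: 'a::zero^4) $ 1 = x"
  "(vector [x, y, z, w] :: 'a::zero^4) $ 2 = y"
  "(vector [x, y, z, w] :: 'a::zero^4) $ 3 = z"
  "(vector [x, y, z, w] :: 'a::zero^4) $ 4 = w"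
  by (simp_all add: vector_def)

lemma block_matrix_nth [simp]:
  "block_matrix A B C D $ 1 = vector [A $ 1 $ 1, A $ 1 $ 2, B $ 1 $ 1, B $ 1 $ 2]"
  "block_matrix A B C D $ 2 = vector [A $ 2 $ 1, A $ 2 $ 2, B $ 2 $ 1, B $ 2 $ 2]"
  "block_matrix A B C D $ 3 = vector [C $ 1 $ 1, C $ 1 $ 2, D $ 1 $ 1, D $ 1 $ 2]"
  "block_matrix A B C D $ 4 = vector [C $ 2 $ 1, C $ 2 $ 2, D $ 2 $ 1, D $ 2 $ 2]"
  by (simp_all add: block_matrix_def)

lemma P_mat_nth [simp]:
  "P_mat e $ 1 = vector [1, - e, 1, - e]"
  "P_mat e $ 2 = vector [e, 1, 0, 0]"
  "P_mat e $ 3 = vector [0, 0, 1 / (1 + e\<^sup>2), - e / (1 + e\<^sup>2)]"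
  "P_mat e $ 4 = vector [0, 0, e / (1 + e\<^sup>2), 1 / (1 + e\<^sup>2)]"
  by (simp_all add: P_mat_def A_mat_def B_mat_def C_mat_def)

lemma symplectic_J_nth [simp]:
  "symplectic_J $ 1 = vector [0, 0, 1, 0]"
  "symplectic_J $ 2 = vector [0, 0, 0, 1]"
  "symplectic_J $ 3 = vector [-1, 0, 0, 0]"
  "symplectic_J $ 4 = vector [0, -1, 0, 0]"
  by (simp_all add: symplectic_J_def mat_def)

lemma one_plus_square_neq_0: "1 + x\<^sup>2 \<noteq> 0" for x :: real
  by (smt (verit) zero_le_power2)

text \<open>Each entry is a rational function of \<open>e\<close> whose denominator never vanishes.
  An arbitrary \<open>S\<close> covers both the half-line of the theorem and the whole line used for
  open preimages.\<close>

lemma continuous_P_mat: "continuous_on S P_mat"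
proof -
  have "continuous_on S (\<lambda>e. P_mat e $ i $ j)" for i j
    using exhaust_4[of i] exhaust_4[of j]
    by (elim disjE) (auto intro!: continuous_intros simp: one_plus_square_neq_0)
  then have "continuous_on S (\<lambda>e. \<chi> i j. P_mat e $ i $ j)"
    by (intro continuous_on_vec_lambda)
  then show ?thesis by simp
qed

text \<open>In block terms the identity says that A^T C = I and that B^T C is symmetric;
  \<open>C_mat e\<close> is \<open>A_mat e\<close> divided by \<open>1 + e\<^sup>2\<close>, which is
  the inverse transpose of \<open>A_mat e\<close>. The proof checks all 16 entries directly.\<close>

lemma P_mat_in_Sp4: "P_mat e \<in> Sp4"
  using one_plus_square_neq_0[of e]
  by (simp add: Sp4_def vec_eq_iff forall_4 matrix_matrix_mult_def transpose_def sum_4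
      field_simps power2_eq_square)

lemma det_P_mat_minus_one: "det (P_mat e - mat 1) = e ^ 4 / (1 + e\<^sup>2)"
proof -
  \<comment> \<open>The two factors are det(A - I) and det(C - I), as the matrix is block
    triangular.\<close>
  have "det (P_mat e - mat 1) = e\<^sup>2 * ((1 / (1 + e\<^sup>2) - 1)\<^sup>2 + (e / (1 + e\<^sup>2))\<^sup>2)"
    by (simp add: det_4 mat_def power2_eq_square algebra_simps)
  also have "(1 / (1 + e\<^sup>2) - 1)\<^sup>2 + (e / (1 + e\<^sup>2))\<^sup>2 = e\<^sup>2 * (1 + e\<^sup>2) / (1 + e\<^sup>2)\<^sup>2"
    using one_plus_square_neq_0[of e] by (simp add: divide_simps) algebra
  finally show ?thesis
    using one_plus_square_neq_0[of e] by (simp add: power2_eq_square power4_eq_xxxx mult.assoc)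
qed

lemma trace_P_mat: "trace (P_mat e) = 2 + 2 / (1 + e\<^sup>2)"
  by (simp add: trace_def sum_4)

lemma P_mat_eigenvalue: "1 + \<i> * complex_of_real e \<in> complex_spectrum (P_mat e)"
proof -
  \<comment> \<open>(i, 1) is an eigenvector of \<open>A_mat e\<close> for 1 + i e; padding with
    zeros works because the lower left block is 0.\<close>
  let ?v = "vector [\<i>, 1, 0, 0] :: complex^4"
  have "?v $ 2 \<noteq> 0" by simp
  then have "?v \<noteq> 0" by (metis zero_index)
  moreover have "map_matrix complex_of_real (P_mat e) *v ?v = (1 + \<i> * complex_of_real e) *s ?v"
    by (simp add: vec_eq_iff forall_4 matrix_vector_mult_def map_matrix_def sum_4 algebra_simps)
  ultimately show ?thesis
    unfolding complex_spectrum_def by blast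
qed

lemma not_elliptic_P_mat:
  assumes "e \<noteq> 0"
  shows "\<not> elliptic (P_mat e)"
proof
  assume "elliptic (P_mat e)"
  then have "1 + \<i> * complex_of_real e \<in> sphere 0 1"
    using P_mat_eigenvalue unfolding elliptic_def by blast
  \<comment> \<open>The squared modulus of 1 + i e is \<open>1 + e\<^sup>2\<close>, which exceeds
    1.\<close>
  then show False
    using assms by (simp add: cmod_def)
qed

text \<open>The only nonzero entry of \<open>P_mat 0 - mat 1\<close> is at (1,3), so the kernel is
  the hyperplane of vectors with vanishing third coordinate.\<close>

lemma dim_ker_P_mat_0: "dim {x. (P_mat 0 - mat 1) *v x = 0} = 3"
proof -
  have "{x. (P_mat 0 - mat 1) *v x = 0} = {x :: real^4. axis 3 1 \<bullet> x = 0}"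
    by (simp add: vec_eq_iff forall_4 matrix_vector_mult_def mat_def sum_4 inner_axis')
  moreover have "axis 3 1 \<noteq> (0 :: real^4)"
    by (simp add: axis_eq_0_iff)
  ultimately show ?thesis
    by (simp add: dim_hyperplane)
qed

lemma complex_spectrum_P_mat_0: "complex_spectrum (P_mat 0) = {1}"
proof -
  have "z = 1" if "z \<in> complex_spectrum (P_mat 0)" for z
  proof -
    from that obtain v :: "complex^4" where "v \<noteq> 0"
      and "map_matrix complex_of_real (P_mat 0) *v v = z *s v"
      unfolding complex_spectrum_def by blast
    \<comment> \<open>If z were not 1, rows 2 to 4 would force those coordinates of v to vanish, and
      then row 1 the first one.\<close>
    then show "z = 1"
      by (auto simp: vec_eq_iff forall_4 matrix_vector_mult_def map_matrix_def sum_4)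
  qed
  with P_mat_eigenvalue[of 0] show ?thesis by auto
qed

theorem mainTheorem1:
  shows "continuous_on {0..} P_mat
    \<and> (\<forall>\<epsilon>::real. \<epsilon> \<ge> 0 \<longrightarrow> P_mat \<epsilon> \<in> Sp4)
    \<and> (P_mat 0 \<noteq> mat 1
        \<and> dim {x. (P_mat 0 - mat 1) *v x = 0} \<noteq> 2
        \<and> complex_spectrum (P_mat 0) = {1})
    \<and> (\<forall>\<epsilon>::real. \<epsilon> > 0 \<longrightarrow>
          det (P_mat \<epsilon> - mat 1) > 0 \<and> trace (P_mat \<epsilon>) < 4 \<and> \<not> elliptic (P_mat \<epsilon>))
    \<and> \<not> (\<exists>U. U \<subseteq> Sp4
          \<and> (\<exists>V. openin (top_of_set Sp4) V \<and> P_mat 0 \<in> V \<and> V \<subseteq> U)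
          \<and> (\<forall>S\<in>U. det (S - mat 1) > 0 \<and> trace S < 4 \<longrightarrow> elliptic S))"
proof -
  have "P_mat 0 $ 1 $ 3 \<noteq> (mat 1 :: real^4^4) $ 1 $ 3"
    by (simp add: mat_def)
  then have neq: "P_mat 0 \<noteq> mat 1" by metis
  have ii: "det (P_mat e - mat 1) > 0 \<and> trace (P_mat e) < 4 \<and> \<not> elliptic (P_mat e)"
    if "e > 0" for e
  proof -
    have "det (P_mat e - mat 1) > 0"
      using that by (simp add: det_P_mat_minus_one add_pos_nonneg)
    moreover have "2 / (1 + e\<^sup>2) < 2"
      using that by (simp add: pos_divide_less_eq add_pos_nonneg)
    ultimately show ?thesis
      using that not_elliptic_P_mat[of e] by (simp add: trace_P_mat)
  qed
  have False if V: "openin (top_of_set Sp4) V" "P_mat 0 \<in> V" "V \<subseteq> U"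
    and ell: "\<forall>S\<in>U. det (S - mat 1) > 0 \<and> trace S < 4 \<longrightarrow> elliptic S" for U V
  proof -
    obtain W where W: "open W" "V = Sp4 \<inter> W"
      using V(1) by (auto simp: openin_open)
    have "open (P_mat -` W)"
      using W(1) continuous_P_mat by (rule open_vimage)
    then obtain d where "d > 0" "ball 0 d \<subseteq> P_mat -` W"
      using V(2) W(2) by (metis IntE openE vimageI)
    \<comment> \<open>A positive parameter is needed: at 0 the determinant vanishes and the
      implication is vacuous.\<close>
    moreover have "d / 2 \<in> ball 0 d"
      using \<open>d > 0\<close> by simp
    ultimately have "P_mat (d / 2) \<in> W" by blast
    then have "P_mat (d / 2) \<in> U"
      using P_mat_in_Sp4 W(2) V(3) by blast
    with ell ii[of "d / 2"] \<open>d > 0\<close> show False by auto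
  qed
  then have "\<not> (\<exists>U. U \<subseteq> Sp4
      \<and> (\<exists>V. openin (top_of_set Sp4) V \<and> P_mat 0 \<in> V \<and> V \<subseteq> U)
      \<and> (\<forall>S\<in>U. det (S - mat 1) > 0 \<and> trace S < 4 \<longrightarrow> elliptic S))"
    by metis
  moreover have "dim {x. (P_mat 0 - mat 1) *v x = 0} \<noteq> 2"
    by (simp add: dim_ker_P_mat_0)
  ultimately show ?thesis
    using continuous_P_mat P_mat_in_Sp4 neq complex_spectrum_P_mat_0 ii by blast
qed

end
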